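(* Let $X$ be a real normed space and $K\subset X$ a closed convex pointed cone (not necessarily with nonempty interior). Let $A,B,C\subset X$ be nonempty sets such that $C$ is weakly $K$-compact, $B$ is open (in the norm topology), and $$A+C\subset C+B+K.$$ Then $$A\subset \operatorname{conv}B+K.$$
   Context: Sums of sets are Minkowski sums; $\operatorname{conv}$ is the convex hull. A cone $K$ is pointed if $K\cap(-K)=\{0\}$. A nonempty set $C\subset X$ is called weakly $K$-compact if from every cover of $C$ by sets of the form $U+K$, with $U\subset X$ weakly open, one can extract a finite subcover. *)

theory Defs
  imports "HOL-Analysis.Analysis" "HOL-Library.Set_Algebras"
begin

text \<open>The coarsest topology for which every continuous real-valued linear functional is
  continuous.\<close>

definition weak_topology :: "'a::real_normed_vector topology" where
  "weak_topology =
    topology_generated_by {f -` V | (f :: 'a \<Rightarrow> real) V. bounded_linear f \<and> open V}"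

lemma topspace_weak_topology [simp]: "topspace weak_topology = UNIV"
proof -
  have "UNIV = (\<lambda>x::'a. 0::real) -` UNIV \<and> bounded_linear (\<lambda>x::'a. 0::real)
      \<and> open (UNIV :: real set)"
    by simp
  then have "(UNIV :: 'a set) \<in> {f -` V | (f :: 'a \<Rightarrow> real) V. bounded_linear f \<and> open V}"
    by blast
  then show ?thesis
    unfolding weak_topology_def topology_generated_by_topspace by blast
qed

text \<open>On sets, unary minus is the complement in HOL, so the reflection of a cone is written
  as an image.\<close>

definition pointed_cone :: "'a::real_vector set \<Rightarrow> bool" where
  "pointed_cone K \<longleftrightarrow> cone K \<and> K \<inter> uminus ` K = {0}"

definition weakly_K_compact :: "'a::real_normed_vector set \<Rightarrow> 'a set \<Rightarrow> bool" where
  "weakly_K_compact K C \<longleftrightarrow>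
    C \<noteq> {} \<and>
    (\<forall>\<W>. (\<forall>W\<in>\<W>. \<exists>U. openin weak_topology U \<and> W = U + K) \<and> C \<subseteq> \<Union>\<W> \<longrightarrow>
      (\<exists>\<V>. \<V> \<subseteq> \<W> \<and> finite \<V> \<and> C \<subseteq> \<Union>\<V>))"

end

theory Submission
  imports Defs
begin

text \<open>If some \<open>a \<in> A\<close> were outside the open convex set \<open>conv B + K\<close>, a bounded linear
  functional \<open>f\<close> would satisfy \<open>f a < f s\<close> on that set; as \<open>K\<close> is a cone, \<open>f \<ge> 0\<close> on \<open>K\<close>. If
  \<open>f\<close> had no minimizer on \<open>C\<close>, the sets \<open>{x. f x > f c} + K\<close> with \<open>c \<in> C\<close> would cover \<open>C\<close>, but
  a finite subfamily misses its \<open>c\<close> with least \<open>f c\<close>. So there is a minimizer \<open>c\<close>, and \<open>a + c \<in> C + B + K\<close> contradicts its minimality.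

  The functional is obtained from a convex cone \<open>M\<close> that is maximal among those avoiding a given
  point \<open>-d\<close>: maximality forces \<open>M \<union> -M\<close> to be the whole space, and \<open>f x = Sup {t. x - t d \<in> M}\<close>.\<close>

section \<open>Convex cones and Zorn's lemma\<close>

lemma convex_cone_Union_chain:
  assumes "\<C> \<noteq> {}" "subset.chain UNIV \<C>" "\<And>M. M \<in> \<C> \<Longrightarrow> convex_cone M"
  shows "convex_cone (\<Union>\<C>)"
  unfolding convex_cone_iff
proof (intro conjI ballI allI impI)
  show "0 \<in> \<Union>\<C>"
    using assms(1,3) convex_cone_contains_0 by blast
next
  fix x y assume "x \<in> \<Union>\<C>" "y \<in> \<Union>\<C>"
  then obtain M N where MN: "M \<in> \<C>" "x \<in> M" "N \<in> \<C>" "y \<in> N" by blast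
  then have "M \<subseteq> N \<or> N \<subseteq> M"
    using assms(2) by (auto simp: subset_chain_def)
  then show "x + y \<in> \<Union>\<C>"
    using MN assms(3) convex_cone_add by blast
next
  fix x and c :: real assume "x \<in> \<Union>\<C>" "0 \<le> c"
  then show "c *\<^sub>R x \<in> \<Union>\<C>"
    using assms(3) convex_cone_scaleR by blast
qed

lemma maximal_convex_cone_avoiding:
  assumes "convex_cone N" "p \<notin> N"
  obtains M where "convex_cone M" "N \<subseteq> M" "p \<notin> M"
    "\<And>L. \<lbrakk>convex_cone L; M \<subseteq> L; p \<notin> L\<rbrakk> \<Longrightarrow> L = M"
proof -
  let ?\<A> = "{M. convex_cone M \<and> N \<subseteq> M \<and> p \<notin> M}"
  have "\<exists>M\<in>?\<A>. \<forall>L\<in>?\<A>. M \<subseteq> L \<longrightarrow> L = M"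
  proof (rule subset_Zorn_nonempty)
    show "?\<A> \<noteq> {}" using assms by blast
  next
    fix \<C> assume "\<C> \<noteq> {}" and chain: "subset.chain ?\<A> \<C>"
    then have sub: "\<C> \<subseteq> ?\<A>" and "subset.chain UNIV \<C>"
      by (auto simp: subset_chain_def)
    then have "convex_cone (\<Union>\<C>)"
      using \<open>\<C> \<noteq> {}\<close> by (intro convex_cone_Union_chain) auto
    then show "\<Union>\<C> \<in> ?\<A>"
      using sub \<open>\<C> \<noteq> {}\<close> by blast
  qed
  then obtain M where M: "M \<in> ?\<A>" and max: "\<forall>L\<in>?\<A>. M \<subseteq> L \<longrightarrow> L = M" by blast
  show thesis
  proof (rule that)
    show "L = M" if "convex_cone L" "M \<subseteq> L" "p \<notin> L" for L
      using max M that by blast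
  qed (use M in auto)
qed

text \<open>This is the smallest convex cone containing \<open>M\<close> and \<open>x\<close>, the
  enlargement against which maximality is tested below.\<close>

lemma convex_cone_add_ray:
  assumes "convex_cone M"
  shows "convex_cone {m + c *\<^sub>R x |m c. m \<in> M \<and> 0 \<le> c}"
  unfolding convex_cone_iff
proof (intro conjI ballI allI impI)
  show "0 \<in> {m + c *\<^sub>R x |m c. m \<in> M \<and> 0 \<le> c}"
    using convex_cone_contains_0[OF assms] by force
next
  fix y z
  assume "y \<in> {m + c *\<^sub>R x |m c. m \<in> M \<and> 0 \<le> c}" "z \<in> {m + c *\<^sub>R x |m c. m \<in> M \<and> 0 \<le> c}"
  then obtain m c n d where "y = m + c *\<^sub>R x" "z = n + d *\<^sub>R x" "m \<in> M" "n \<in> M" "0 \<le> c" "0 \<le> d"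
    by blast
  then have "y + z = (m + n) + (c + d) *\<^sub>R x" "m + n \<in> M" "0 \<le> c + d"
    using assms by (auto simp: algebra_simps convex_cone_add)
  then show "y + z \<in> {m + c *\<^sub>R x |m c. m \<in> M \<and> 0 \<le> c}" by blast
next
  fix y and r :: real
  assume "y \<in> {m + c *\<^sub>R x |m c. m \<in> M \<and> 0 \<le> c}" "0 \<le> r"
  then obtain m c where "y = m + c *\<^sub>R x" "m \<in> M" "0 \<le> c" by blast
  then have "r *\<^sub>R y = r *\<^sub>R m + (r * c) *\<^sub>R x" "r *\<^sub>R m \<in> M" "0 \<le> r * c"
    using assms \<open>0 \<le> r\<close> by (auto simp: algebra_simps convex_cone_scaleR)
  then show "r *\<^sub>R y \<in> {m + c *\<^sub>R x |m c. m \<in> M \<and> 0 \<le> c}" by blast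
qed

text \<open>If neither \<open>x\<close> nor \<open>-x\<close> lay in \<open>M\<close>, adjoining
  either ray would by maximality capture \<open>p\<close>; the two resulting representations of
  \<open>p\<close> combine to put \<open>p\<close> in \<open>M\<close> itself.\<close>

lemma maximal_convex_cone_total:
  assumes M: "convex_cone M" and p: "p \<notin> M"
    and max: "\<And>L. \<lbrakk>convex_cone L; M \<subseteq> L; p \<notin> L\<rbrakk> \<Longrightarrow> L = M"
  shows "x \<in> M \<or> -x \<in> M"
proof (rule ccontr)
  assume neg: "\<not> ?thesis"
  have ray: "\<exists>m c. m \<in> M \<and> 0 < c \<and> p = m + c *\<^sub>R y" if "y \<notin> M" for y
  proof -
    let ?L = "{m + c *\<^sub>R y |m c. m \<in> M \<and> 0 \<le> c}"
    have "y = 0 + 1 *\<^sub>R y" by simp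
    then have "y \<in> ?L" using convex_cone_contains_0[OF M] zero_le_one by blast
    moreover have "M \<subseteq> ?L" by force
    ultimately have "p \<in> ?L"
      using max convex_cone_add_ray[OF M] that by blast
    then obtain m c where mc: "m \<in> M" "0 \<le> c" "p = m + c *\<^sub>R y" by blast
    with p have "c \<noteq> 0" by auto
    with mc show ?thesis by (metis order_le_less)
  qed
  obtain m s where m: "m \<in> M" "0 < s" "p = m + s *\<^sub>R x" using ray neg by blast
  obtain n t where n: "n \<in> M" "0 < t" "p = n + t *\<^sub>R (-x)" using ray neg by blast
  \<comment> \<open>The crossed weights \<open>t\<close> and \<open>s\<close> cancel the multiples
    of \<open>x\<close>, so \<open>p\<close> becomes a conic combination of \<open>m\<close> and
    \<open>n\<close>.\<close>
  have "t *\<^sub>R p + s *\<^sub>R p = t *\<^sub>R (m + s *\<^sub>R x) + s *\<^sub>R (n + t *\<^sub>R (-x))"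
    using m(3) n(3) by simp
  then have "(t + s) *\<^sub>R p = t *\<^sub>R m + s *\<^sub>R n"
    by (simp add: algebra_simps)
  then have "(1 / (t + s)) *\<^sub>R ((t + s) *\<^sub>R p) = (1 / (t + s)) *\<^sub>R (t *\<^sub>R m + s *\<^sub>R n)"
    by simp
  then have "p = (1 / (t + s)) *\<^sub>R (t *\<^sub>R m + s *\<^sub>R n)"
    using m(2) n(2) by (simp del: scaleR_add_right)
  moreover have "\<dots> \<in> M"
    using M m n by (intro convex_cone_scaleR convex_cone_add) auto
  ultimately show False using p by simp
qed

section \<open>Functionals from total cones, and separation from open convex sets\<close>

lemma total_convex_cone_functional:
  fixes d :: "'a::real_normed_vector"
  assumes M: "convex_cone M" and total: "\<And>x. x \<in> M \<or> -x \<in> M"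
    and neg: "-d \<notin> M" and e: "0 < e" "ball d e \<subseteq> M"
  obtains f where "bounded_linear f"
    "\<And>x t. x - t *\<^sub>R d \<in> M \<Longrightarrow> t \<le> f x"
proof -
  \<comment> \<open>Read \<open>x - y \<in> M\<close> as "y is below x". Then \<open>S x\<close>
    records the multiples of \<open>d\<close> below \<open>x\<close>, and \<open>f x\<close> is the
    threshold where they stop being below.\<close>
  define S where "S x = {t. x - t *\<^sub>R d \<in> M}" for x
  define f where "f x = Sup (S x)" for x
  \<comment> \<open>If a lower multiple exceeded an upper one, adding the two elements of
    \<open>M\<close> would give a positive multiple of \<open>-d\<close>, hence
    \<open>-d \<in> M\<close>.\<close>
  have gap: "s \<le> t" if "x - s *\<^sub>R d \<in> M" "t *\<^sub>R d - x \<in> M" for x s t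
  proof (rule ccontr)
    assume "\<not> s \<le> t"
    have "(x - s *\<^sub>R d) + (t *\<^sub>R d - x) \<in> M" using M that by (rule convex_cone_add)
    then have "(1 / (s - t)) *\<^sub>R ((x - s *\<^sub>R d) + (t *\<^sub>R d - x)) \<in> M"
      using M \<open>\<not> s \<le> t\<close> by (intro convex_cone_scaleR) auto
    moreover have "(x - s *\<^sub>R d) + (t *\<^sub>R d - x) = (s - t) *\<^sub>R (- d)"
      by (simp add: algebra_simps)
    ultimately show False using neg \<open>\<not> s \<le> t\<close> by simp
  qed
  \<comment> \<open>\<open>d\<close> is an order unit: scaling the ball around \<open>d\<close> by
    \<open>t\<close> absorbs all vectors of norm below \<open>e * t\<close>. This also yields the
    norm bound \<open>1 / e\<close> at the end.\<close>
  have unit: "x + t *\<^sub>R d \<in> M" if "norm x < e * t" for x t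
  proof -
    have "0 < t"
      using that e(1) norm_ge_zero[of x] by (smt (verit) zero_less_mult_pos)
    then have "norm ((1/t) *\<^sub>R x) < e"
      using that by (simp add: field_simps)
    then have "d + (1/t) *\<^sub>R x \<in> M"
      using e(2) by (auto simp: dist_norm subset_iff)
    then have "t *\<^sub>R (d + (1/t) *\<^sub>R x) \<in> M"
      using M \<open>0 < t\<close> by (simp add: convex_cone_scaleR)
    then show ?thesis using \<open>0 < t\<close> by (simp add: algebra_simps)
  qed
  have bound: "-t \<in> S x" "\<And>s. s \<in> S x \<Longrightarrow> s \<le> t" if "norm x < e * t" for x t
    using unit[of x t] unit[of "-x" t] that gap[of x _ t] by (auto simp: S_def)
  \<comment> \<open>The \<open>+ 1\<close> makes the inequality strict, so \<open>bound\<close>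
    applies to every \<open>x\<close> and \<open>S x\<close> is nonempty and bounded above.\<close>
  have ex: "norm x < e * ((norm x + 1) / e)" for x :: 'a
    using e(1) by simp
  have ne: "S x \<noteq> {}" and bdd: "bdd_above (S x)" for x
    using bound(1)[OF ex[of x]] bdd_aboveI[OF bound(2)[OF ex[of x]]] by auto
  have lower: "t \<le> f x" if "x - t *\<^sub>R d \<in> M" for x t
    unfolding f_def using that bdd by (intro cSup_upper) (auto simp: S_def)
  have upper: "f x \<le> t" if "t *\<^sub>R d - x \<in> M" for x t
    unfolding f_def using ne gap that by (intro cSup_least) (auto simp: S_def)
  \<comment> \<open>Totality makes \<open>f x\<close> a two-sided threshold. As \<open>M\<close>
    need not be closed, nothing is claimed at \<open>t = f x\<close>, and the linearity arguments
    allow an error \<open>r\<close>.\<close>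
  have below: "x - t *\<^sub>R d \<in> M" if "t < f x" for x t
    using total[of "x - t *\<^sub>R d"] upper[of t x] that by auto
  have above: "t *\<^sub>R d - x \<in> M" if "f x < t" for x t
    using total[of "x - t *\<^sub>R d"] lower[of x t] that by auto
  have add: "f (x + y) = f x + f y" for x y
  proof (rule antisym)
    show "f (x + y) \<le> f x + f y"
    proof (rule field_le_epsilon)
      fix r :: real assume "0 < r"
      then have "((f x + r/2) *\<^sub>R d - x) + ((f y + r/2) *\<^sub>R d - y) \<in> M"
        using M above by (intro convex_cone_add) auto
      moreover have "((f x + r/2) *\<^sub>R d - x) + ((f y + r/2) *\<^sub>R d - y)
          = ((f x + r/2) + (f y + r/2)) *\<^sub>R d - (x + y)"
        by (simp only: scaleR_add_left) (simp add: algebra_simps)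
      ultimately have "f (x + y) \<le> (f x + r/2) + (f y + r/2)"
        using upper by metis
      then show "f (x + y) \<le> f x + f y + r" by simp
    qed
    show "f x + f y \<le> f (x + y)"
    proof (rule field_le_epsilon)
      fix r :: real assume "0 < r"
      then have "(x - (f x - r/2) *\<^sub>R d) + (y - (f y - r/2) *\<^sub>R d) \<in> M"
        using M below by (intro convex_cone_add) auto
      moreover have "(x - (f x - r/2) *\<^sub>R d) + (y - (f y - r/2) *\<^sub>R d)
          = (x + y) - ((f x - r/2) + (f y - r/2)) *\<^sub>R d"
        by (simp only: scaleR_add_left) (simp add: algebra_simps)
      ultimately have "(f x - r/2) + (f y - r/2) \<le> f (x + y)"
        using lower by metis
      then show "f x + f y \<le> f (x + y) + r" by simp
    qed
  qed
  have zero: "f 0 = 0" using add[of 0 0] by simp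
  have minus: "f (-x) = - f x" for x using add[of x "-x"] zero by simp
  have scale_le: "c * f x \<le> f (c *\<^sub>R x)" if "0 < c" for c x
  proof (rule field_le_epsilon)
    fix r :: real assume "0 < r"
    \<comment> \<open>The error is \<open>r / c\<close> so that it becomes \<open>r\<close> after
      scaling by \<open>c\<close>.\<close>
    then have "c *\<^sub>R (x - (f x - r/c) *\<^sub>R d) \<in> M"
      using M below that by (intro convex_cone_scaleR) auto
    then have "c *\<^sub>R x - (c * (f x - r/c)) *\<^sub>R d \<in> M"
      by (simp add: scaleR_diff_right)
    then have "c * (f x - r/c) \<le> f (c *\<^sub>R x)" by (rule lower)
    then show "c * f x \<le> f (c *\<^sub>R x) + r"
      using that by (simp add: right_diff_distrib)
  qed
  \<comment> \<open>Since \<open>f\<close> is odd, the inequality at \<open>-x\<close> is the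
    reverse inequality at \<open>x\<close>.\<close>
  have scale_pos: "f (c *\<^sub>R x) = c * f x" if "0 < c" for c x
    using scale_le[OF that, of x] scale_le[OF that, of "-x"] by (simp add: minus)
  have scale: "f (c *\<^sub>R x) = c * f x" for c x
    using scale_pos[of c x] scale_pos[of "-c" x]
    by (cases c "0::real" rule: linorder_cases) (auto simp: zero minus)
  have "\<bar>f x\<bar> \<le> norm x * (1 / e)" for x
  proof (rule field_le_epsilon)
    fix r :: real assume "0 < r"
    then have "norm x < e * (norm x / e + r)"
      using e(1) by (simp add: distrib_left)
    from unit[OF this] unit[of "-x" "norm x / e + r"] this
    have "- (norm x / e + r) \<le> f x" "f x \<le> norm x / e + r"
      by (auto intro!: upper lower simp del: minus_add_distrib)
    then show "\<bar>f x\<bar> \<le> norm x * (1 / e) + r" by simp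
  qed
  then have "bounded_linear f"
    using add scale by (intro bounded_linear_intro[where K = "1 / e"]) auto
  then show thesis using lower that by blast
qed

text \<open>The cone generated by \<open>D\<close> is enlarged to a total cone avoiding
  \<open>-d\<close> for some \<open>d \<in> D\<close>; openness of \<open>D\<close> supplies the
  ball around \<open>d\<close> and, later, strict positivity.\<close>

lemma open_convex_zero_separation:
  fixes D :: "'a::real_normed_vector set"
  assumes "open D" "convex D" "0 \<notin> D"
  obtains f :: "'a \<Rightarrow> real" where "bounded_linear f" "\<And>x. x \<in> D \<Longrightarrow> 0 < f x"
proof (cases "D = {}")
  case True
  then show thesis using that[of "\<lambda>_. 0"] by simp
next
  case False
  then obtain d where d: "d \<in> D" by blast
  then obtain e where e: "0 < e" "ball d e \<subseteq> D"
    using \<open>open D\<close> open_contains_ball by blast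
  \<comment> \<open>Otherwise \<open>-d = c *\<^sub>R x\<close> with \<open>x \<in> D\<close> and
    \<open>c \<ge> 0\<close>, and the convex combination of \<open>d\<close> and \<open>x\<close>
    with weights proportional to \<open>1\<close> and \<open>c\<close> is \<open>0\<close>, which is
    not in \<open>D\<close>.\<close>
  have "-d \<notin> convex_cone hull D"
  proof
    assume "-d \<in> convex_cone hull D"
    then obtain x c where x: "x \<in> D" "0 \<le> c" "-d = c *\<^sub>R x"
      using False \<open>convex D\<close> by (auto simp: convex_cone_hull_convex_hull_nonempty convex_hull_eq[THEN iffD2])
    have "(1 / (1 + c)) *\<^sub>R d + (c / (1 + c)) *\<^sub>R x \<in> D"
      using x d \<open>convex D\<close> by (intro convexD) (auto simp: add_divide_distrib[symmetric])
    moreover have "(1 / (1 + c)) *\<^sub>R d + (c / (1 + c)) *\<^sub>R x = (1 / (1 + c)) *\<^sub>R (d + c *\<^sub>R x)"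
      by (simp add: scaleR_add_right)
    ultimately show False using x(3)[symmetric] \<open>0 \<notin> D\<close> by simp
  qed
  then obtain M where M: "convex_cone M" "convex_cone hull D \<subseteq> M" "-d \<notin> M"
    and max: "\<And>L. \<lbrakk>convex_cone L; M \<subseteq> L; -d \<notin> L\<rbrakk> \<Longrightarrow> L = M"
    using maximal_convex_cone_avoiding[OF convex_cone_convex_cone_hull] by metis
  have DM: "D \<subseteq> M" using M(2) hull_subset[of D convex_cone] by blast
  have total: "x \<in> M \<or> -x \<in> M" for x
    using M(1,3) max by (rule maximal_convex_cone_total)
  obtain f where f: "bounded_linear f" "\<And>x t. x - t *\<^sub>R d \<in> M \<Longrightarrow> t \<le> f x"
    by (rule total_convex_cone_functional[OF M(1) total M(3) e(1) order_trans[OF e(2) DM]]) (rule that)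
  have "0 < f x" if "x \<in> D" for x
  proof -
    obtain r where r: "0 < r" "ball x r \<subseteq> D"
      using \<open>x \<in> D\<close> \<open>open D\<close> open_contains_ball by blast
    \<comment> \<open>This choice gives \<open>t * norm d \<le> r / 2\<close>, so
      \<open>x - t *\<^sub>R d\<close> stays in \<open>D\<close> and hence in \<open>M\<close>,
      which forces \<open>f x \<ge> t > 0\<close>.\<close>
    define t where "t = r / (2 * (norm d + 1))"
    have "0 < t" using r(1) by (simp add: t_def add_nonneg_pos)
    have "t * norm d \<le> t * (norm d + 1)" using \<open>0 < t\<close> by simp
    also have "\<dots> = r / 2"
      using norm_ge_zero[of d] by (simp add: t_def add_nonneg_eq_0_iff field_simps)
    finally have "t * norm d < r" using r(1) by simp
    then have "x - t *\<^sub>R d \<in> ball x r"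
      using \<open>0 < t\<close> by (simp add: dist_norm)
    then show ?thesis using f(2)[of x t] r(2) DM \<open>0 < t\<close> by force
  qed
  then show thesis using f(1) that by blast
qed

lemma open_convex_point_separation:
  fixes S :: "'a::real_normed_vector set"
  assumes "open S" "convex S" "a \<notin> S"
  obtains f :: "'a \<Rightarrow> real" where "bounded_linear f" "\<And>x. x \<in> S \<Longrightarrow> f a < f x"
proof -
  have "open ((+) (-a) ` S)" "convex ((+) (-a) ` S)" "0 \<notin> (+) (-a) ` S"
    using open_translation[OF assms(1), of "-a"] convex_translation[OF assms(2), of "-a"] assms(3)
    by auto
  then obtain f :: "'a \<Rightarrow> real" where f: "bounded_linear f" "\<And>x. x \<in> (+) (-a) ` S \<Longrightarrow> 0 < f x"
    using open_convex_zero_separation by blast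
  have "f a < f x" if "x \<in> S" for x
    using f(2)[of "-a + x"] that
    by (simp add: linear_diff[OF bounded_linear.linear[OF f(1)]])
  then show thesis using f(1) that by blast
qed

section \<open>Open sums, functionals on cones, and minimizers on weakly K-compact sets\<close>

lemma open_set_plus_left:
  fixes S T :: "'a::real_normed_vector set"
  assumes "open S"
  shows "open (S + T)"
proof -
  have "S + T = (\<Union>t\<in>T. (+) t ` S)"
    by (force simp: set_plus_def add.commute)
  then show ?thesis using assms by (simp add: open_translation open_UN)
qed

text \<open>Multiples of a vector with negative value remain in the cone and push \<open>f\<close>
  below every bound.\<close>

lemma bounded_below_on_cone_nonneg:
  fixes f :: "'a::real_vector \<Rightarrow> real"
  assumes "linear f" "cone K" "\<And>k. k \<in> K \<Longrightarrow> b \<le> f k" "k \<in> K"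
  shows "0 \<le> f k"
proof (rule ccontr)
  assume "\<not> 0 \<le> f k"
  then obtain n :: nat where "- b < real n * - f k"
    using reals_Archimedean3[of "- f k"] by (metis neg_0_less_iff_less not_le)
  moreover have "real n *\<^sub>R k \<in> K"
    using assms(2,4) by (simp add: cone_def)
  then have "b \<le> real n * f k"
    using assms(3) linear_scale[OF assms(1)] by fastforce
  ultimately show False by simp
qed

lemma weakly_K_compact_attains_min:
  fixes f :: "'a::real_normed_vector \<Rightarrow> real"
  assumes C: "weakly_K_compact K C" and f: "bounded_linear f"
    and K: "0 \<in> K" "\<And>k. k \<in> K \<Longrightarrow> 0 \<le> f k"
  obtains c where "c \<in> C" "\<And>x. x \<in> C \<Longrightarrow> f c \<le> f x"
proof -
  have "\<exists>c\<in>C. \<forall>x\<in>C. f c \<le> f x"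
  proof (rule ccontr)
    assume neg: "\<not> ?thesis"
    define W where "W c = f -` {f c<..} + K" for c
    \<comment> \<open>Adding \<open>K\<close> to the half-space cannot lower \<open>f\<close>, so in
      particular \<open>c\<close> is not in \<open>W c\<close>.\<close>
    have W: "f c < f x" if x: "x \<in> W c" for c x
    proof -
      obtain u k where "x = u + k" "f c < f u" "k \<in> K"
        using x unfolding W_def by (auto elim: set_plus_elim)
      then show ?thesis
        using K(2)[of k] by (simp add: linear_add[OF bounded_linear.linear[OF f]])
    qed
    have "openin weak_topology (f -` {f c<..})" for c
      unfolding weak_topology_def
    proof (rule topology_generated_by_Basis)
      show "f -` {f c<..} \<in> {f -` V |(f :: 'a \<Rightarrow> real) V. bounded_linear f \<and> open V}"
        using f open_greaterThan[of "f c"] by blast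
    qed
    then have "\<forall>V\<in>W ` C. \<exists>U. openin weak_topology U \<and> V = U + K"
      unfolding W_def by blast
    moreover have "C \<subseteq> \<Union>(W ` C)"
    proof
      fix x assume "x \<in> C"
      then obtain c where "c \<in> C" "f c < f x" using neg by force
      then have "x + 0 \<in> W c" unfolding W_def using K(1) by (intro set_plus_intro) auto
      then show "x \<in> \<Union>(W ` C)" using \<open>c \<in> C\<close> by auto
    qed
    ultimately have "\<exists>\<V>. \<V> \<subseteq> W ` C \<and> finite \<V> \<and> C \<subseteq> \<Union>\<V>"
      using C unfolding weakly_K_compact_def by blast
    then obtain F where F: "F \<subseteq> C" "finite F" "C \<subseteq> \<Union>(W ` F)"
      by (metis finite_subset_image)
    have "F \<noteq> {}" using C F(3) by (auto simp: weakly_K_compact_def)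
    then obtain c where c: "c \<in> F" "\<And>x. x \<in> F \<Longrightarrow> f c \<le> f x"
      using F(2) by (metis arg_min_if_finite(1) arg_min_least)
    then obtain x where "x \<in> F" "c \<in> W x" using F by blast
    then show False using W c(2) by force
  qed
  then show thesis using that by blast
qed

theorem proposition2p8:
  fixes K A B C :: "'a::real_normed_vector set"
  assumes "closed K" and "convex K" and "pointed_cone K"
    and "A \<noteq> {}" and "B \<noteq> {}" and "C \<noteq> {}"
    and "weakly_K_compact K C"
    and "open B"
    and "A + C \<subseteq> C + B + K"
  shows "A \<subseteq> (convex hull B) + K"
proof
  fix a assume "a \<in> A"
  show "a \<in> (convex hull B) + K"
  proof (rule ccontr)
    assume "a \<notin> (convex hull B) + K"
    moreover have "open ((convex hull B) + K)"
      using \<open>open B\<close> by (simp add: open_set_plus_left open_convex_hull)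
    moreover have "convex ((convex hull B) + K)"
      using \<open>convex K\<close> by (simp add: convex_set_plus)
    ultimately obtain f :: "'a \<Rightarrow> real" where f: "bounded_linear f"
      and sep: "\<And>x. x \<in> (convex hull B) + K \<Longrightarrow> f a < f x"
      using open_convex_point_separation by blast
    note lin = bounded_linear.linear[OF f]
    \<comment> \<open>This is used twice: with \<open>b\<close> fixed it bounds \<open>f\<close>
      below on \<open>K\<close>, and with the \<open>b\<close> and \<open>k\<close> coming from
      \<open>a + c\<close> it gives the contradiction.\<close>
    have less: "f a < f b + f k" if "b \<in> B" "k \<in> K" for b k
      using sep[of "b + k"] that hull_inc[of b B convex]
      by (simp add: set_plus_intro linear_add[OF lin])
    have K: "cone K" "0 \<in> K"
      using \<open>pointed_cone K\<close> by (auto simp: pointed_cone_def)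
    obtain b where "b \<in> B" using \<open>B \<noteq> {}\<close> by blast
    then have "f a - f b \<le> f k" if "k \<in> K" for k
      using less[OF _ that] by force
    then have "0 \<le> f k" if "k \<in> K" for k
      using bounded_below_on_cone_nonneg[OF lin K(1)] that by blast
    then obtain c where c: "c \<in> C" "\<And>x. x \<in> C \<Longrightarrow> f c \<le> f x"
      using weakly_K_compact_attains_min[OF \<open>weakly_K_compact K C\<close> f K(2)] by blast
    have "a + c \<in> C + B + K"
      using \<open>a \<in> A\<close> c(1) \<open>A + C \<subseteq> C + B + K\<close> by blast
    then obtain c' b k where x: "c' \<in> C" "b \<in> B" "k \<in> K" "a + c = c' + b + k"
      by (elim set_plus_elim) auto
    \<comment> \<open>Adding \<open>f c \<le> f c'\<close> to \<open>f a < f b + f k\<close> makes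
      the left side strictly smaller than the right.\<close>
    then have "f a + f c = f c' + f b + f k"
      by (metis linear_add[OF lin])
    then show False using c(2)[OF x(1)] less[OF x(2,3)] by simp
  qed
qed

end
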